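(* Let $\nu>0$ be real and let $m\ge 0$ be an integer. Then the positive zeros of $J_\nu'$ and of $R^{*}_{m,\nu}J_{\nu+m}$ are interlaced in the sense that $$0<j'_{\nu,k_1}<\omega^{*}_{m,\nu,1}<j'_{\nu,k_2}<\omega^{*}_{m,\nu,2}<\cdots .$$
   Context: $J_\nu$ denotes the Bessel function of the first kind of order $\nu$, considered for $x>0$, and $J_\nu'$ its derivative in $x$; $\{j'_{\nu,k}\}_{k=1}^\infty$ is the sequence of all positive zeros of $J_\nu'$ in increasing order. For a nonnegative integer $n$ and real $\lambda>0$, the Lommel polynomial (a polynomial in $1/x$) is $$R_{n,\lambda}(x)=\sum_{k=0}^{\lfloor n/2\rfloor}(-1)^k\binom{n-k}{k}\frac{\Gamma(\lambda+n-k)}{\Gamma(\lambda+k)}\left(\frac{x}{2}\right)^{2k-n},\qquad x>0,$$ extended by $R_{-1,\lambda}\equiv 0$ and $R_{-2,\lambda}\equiv -1$. The associated polynomial is $R^{*}_{m,\nu}(x)=\frac12\left(R_{m,\nu}(x)-R_{m-2,\nu+2}(x)\right)$; e.g. $R^*_{0,\nu}(x)=1$, $R^*_{1,\nu}(x)=\nu/x$, $R^*_{2,\nu}(x)=2\nu(\nu+1)/x^2-1$. $\mathcal{N}^*_{m,\nu}=\{j'_{\nu,k}: k\ge 1,\ J_{\nu+m}(j'_{\nu,k})=0\}$ is the set of positive zeros common to $J_\nu'$ and $J_{\nu+m}$ (possibly empty). The sequence $\{j'_{\nu,k_\ell}\}_{\ell=1}^\infty$ is the increasing enumeration of $\{j'_{\nu,k}\}_{k=1}^\infty\setminus\mathcal{N}^*_{m,\nu}$.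 The sequence $\{\omega^*_{m,\nu,k}\}_{k=1}^\infty$ is the increasing enumeration of the set $\{x>0: J_{\nu+m}(x)=0\}\cup\{x>0: R^*_{m,\nu}(x)=0\}$ (a set union, each element listed once; the elements of $\mathcal{N}^*_{m,\nu}$ are not removed from it). *)

theory Defs
  imports "HOL-Analysis.Analysis"
begin

text \<open>
  Meaningful for \<open>x > 0\<close>. As \<^const>\<open>rGamma\<close> is the entire function \<open>1 / Gamma\<close>, the
  terms with \<open>\<nu> + k + 1\<close> at a pole of \<^const>\<open>Gamma\<close> vanish, as usual.
\<close>
definition bessel_J :: "real \<Rightarrow> real \<Rightarrow> real" where
  "bessel_J \<nu> x =
     (\<Sum>k. (-1) ^ k * rGamma (\<nu> + real k + 1) / fact k * (x / 2) powr (2 * real k + \<nu>))"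

definition bessel_J' :: "real \<Rightarrow> real \<Rightarrow> real" where
  "bessel_J' \<nu> = deriv (bessel_J \<nu>)"

text \<open>
  The index is an integer because the Lommel polynomials are extended to
  \<open>n = -1\<close> (value \<open>0\<close>) and \<open>n = -2\<close> (value \<open>-1\<close>); indices below \<open>-2\<close> are never used.
\<close>
definition lommel_R :: "int \<Rightarrow> real \<Rightarrow> real \<Rightarrow> real" where
  "lommel_R n l x =
     (if n = -2 then -1
      else if n < 0 then 0
      else \<Sum>k = 0..nat n div 2.
             (-1) ^ k * real ((nat n - k) choose k)
               * (Gamma (l + of_int n - real k) / Gamma (l + real k))
               * (x / 2) powi (2 * int k - n))"

definition lommel_R_star :: "nat \<Rightarrow> real \<Rightarrow> real \<Rightarrow> real" where
  "lommel_R_star m \<nu> x = (lommel_R (int m) \<nu> x - lommel_R (int m - 2) (\<nu> + 2) x) / 2"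

definition bessel_J'_zeros :: "real \<Rightarrow> real set" where
  "bessel_J'_zeros \<nu> = {x. x > 0 \<and> bessel_J' \<nu> x = 0}"

definition common_zeros :: "nat \<Rightarrow> real \<Rightarrow> real set" where
  "common_zeros m \<nu> = {x \<in> bessel_J'_zeros \<nu>. bessel_J (\<nu> + real m) x = 0}"

definition omega_set :: "nat \<Rightarrow> real \<Rightarrow> real set" where
  "omega_set m \<nu> =
     {x. x > 0 \<and> bessel_J (\<nu> + real m) x = 0} \<union> {x. x > 0 \<and> lommel_R_star m \<nu> x = 0}"

text \<open>
  For a given \<open>S\<close> there is at most one such sequence \<open>a\<close>, and \<open>S\<close> is then infinite.
  Sequences start at index \<open>0\<close>, so \<open>a l\<close> is the entry usually numbered \<open>l + 1\<close>.
\<close>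
definition increasing_enumeration :: "real set \<Rightarrow> (nat \<Rightarrow> real) \<Rightarrow> bool" where
  "increasing_enumeration S a \<longleftrightarrow> strict_mono a \<and> range a = S"

end

theory Submission
  imports Defs
begin

text \<open>
  Write \<open>u\<^sub>n\<close> for the Bessel function of order \<open>\<nu> + n\<close> and \<open>v\<^sub>n = lommel_R_star n \<nu>\<close>. Both solve the
  three-term recurrence \<open>y\<^sub>n\<^sub>+\<^sub>2 = 2 (\<nu> + n + 1) / x * y\<^sub>n\<^sub>+\<^sub>1 - y\<^sub>n\<close>, so their Casoratian
  \<open>u\<^sub>n v\<^sub>n\<^sub>+\<^sub>1 - u\<^sub>n\<^sub>+\<^sub>1 v\<^sub>n\<close> does not depend on \<open>n\<close>; for \<open>n = 0\<close> it is \<open>bessel_J' \<nu>\<close>. Hence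
  \<open>bessel_J' \<nu> / (u\<^sub>m v\<^sub>m) = v\<^sub>m\<^sub>+\<^sub>1 / v\<^sub>m - u\<^sub>m\<^sub>+\<^sub>1 / u\<^sub>m\<close>, and both terms on the right are strictly
  decreasing in \<open>x\<close> between their poles (identities of Christoffel--Darboux type). The zeros and
  poles of such a function alternate, and near \<open>0\<close> the function is positive, so a zero comes first.
  Zeros common to \<open>bessel_J' \<nu>\<close> and \<open>u\<^sub>m\<close> are zeros of \<open>v\<^sub>m\<close> as well, hence still poles.
\<close>

section \<open>Zeros and poles of a decreasing function\<close>

text \<open>Finiteness below every bound gives each real number a next element of \<open>Z\<close>,
  so iterating "next" from the least element enumerates \<open>Z\<close>. The two extra conclusions
  say that \<open>Z\<close> misses the gaps of the enumeration; they keep the intervals between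
  consecutive poles free of poles.\<close>

lemma increasing_enumeration_exists:
  fixes Z :: "real set"
  assumes fin: "\<And>b. finite (Z \<inter> {..b})" and unb: "\<And>b. \<exists>z\<in>Z. z > b"
  obtains a where "increasing_enumeration Z a"
    and "\<And>l y. y \<in> Z \<Longrightarrow> y < a (Suc l) \<Longrightarrow> y \<le> a l"
    and "\<And>y. y \<in> Z \<Longrightarrow> a 0 \<le> y"
proof -
  have step: "\<exists>n\<in>Z. b < n \<and> (\<forall>y\<in>Z. b < y \<longrightarrow> n \<le> y)" for b
  proof -
    obtain z where z: "z \<in> Z" "z > b" using unb by blast
    \<comment> \<open>Cutting off at some \<open>z\<close> beyond \<open>b\<close> leaves a nonempty
      finite set, whose minimum is the next element.\<close>
    let ?S = "Z \<inter> {..z} \<inter> {b<..}"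
    have S: "finite ?S" "z \<in> ?S" using fin z by auto
    then have M: "Min ?S \<in> ?S" by (intro Min_in) auto
    have "Min ?S \<le> y" if "y \<in> Z" "b < y" for y
    proof (cases "y \<le> z")
      case True
      then show ?thesis using that S by (intro Min_le) auto
    next
      case False
      moreover have "Min ?S \<le> z" using S by (intro Min_le) auto
      ultimately show ?thesis by simp
    qed
    then show ?thesis using M by blast
  qed
  then obtain nx where nx: "\<And>b. nx b \<in> Z" "\<And>b. b < nx b"
      "\<And>b y. y \<in> Z \<Longrightarrow> b < y \<Longrightarrow> nx b \<le> y"
    by metis
  obtain z0 where z0: "z0 \<in> Z" using unb by blast
  define S0 where "S0 = Z \<inter> {..z0}"
  have S0: "finite S0" "z0 \<in> S0" using fin z0 by (auto simp: S0_def)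
  define m0 where "m0 = Min S0"
  have "m0 \<in> S0" unfolding m0_def using S0 by (intro Min_in) auto
  then have m0Z: "m0 \<in> Z" by (simp add: S0_def)
  have m0: "m0 \<le> y" if "y \<in> Z" for y
  proof (cases "y \<le> z0")
    case True
    then show ?thesis unfolding m0_def using that S0 by (intro Min_le) (auto simp: S0_def)
  next
    case False
    moreover have "m0 \<le> z0" unfolding m0_def using S0 by (intro Min_le) auto
    ultimately show ?thesis by simp
  qed
  define a where "a l = (nx ^^ l) m0" for l
  have a0: "a 0 = m0" and aS: "a (Suc l) = nx (a l)" for l by (simp_all add: a_def)
  have mono: "strict_mono a" using nx(2) by (simp add: strict_mono_Suc_iff aS)
  have aZ: "a l \<in> Z" for l by (cases l) (simp_all add: a0 aS m0Z nx(1))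
  have gap: "y \<le> a l" if "y \<in> Z" "y < a (Suc l)" for y l
    using nx(3)[of y "a l"] that aS[of l] by force
  have "y \<in> range a" if y: "y \<in> Z" for y
  proof (rule ccontr)
    assume ny: "y \<notin> range a"
    have "a l \<le> y" for l
    proof (induction l)
      case 0
      show ?case using m0 y a0 by simp
    next
      case (Suc l)
      then have "a l < y" using ny by (metis le_less rangeI)
      then show ?case using nx(3) y aS by simp
    qed
    \<comment> \<open>An element missed by the enumeration would lie above all its terms, confining
      an infinite set to a finite one.\<close>
    then have "range a \<subseteq> Z \<inter> {..y}" using aZ by auto
    then have "finite (range a)" using fin finite_subset by blast
    moreover have "inj a" using mono by (rule strict_mono_imp_inj_on)
    ultimately show False using finite_imageD by blast
  qed
  then have "range a = Z" using aZ by auto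
  with mono have "increasing_enumeration Z a" by (simp add: increasing_enumeration_def)
  then show thesis using that gap m0 a0 by simp
qed

text \<open>The intermediate value theorem gives existence and strict monotonicity uniqueness. Only
  signs near the ends are asked for, not infinite limits, so that \<open>a\<close> may be the origin
  as well as a pole.\<close>

lemma decreasing_unique_zero:
  fixes q :: "real \<Rightarrow> real"
  assumes "a < b"
    and deriv: "\<And>x. a < x \<Longrightarrow> x < b \<Longrightarrow> \<exists>d<0. (q has_real_derivative d) (at x)"
    and right: "\<forall>\<^sub>F x in at_right a. q x > 0" and left: "\<forall>\<^sub>F x in at_left b. q x < 0"
  shows "\<exists>!x. a < x \<and> x < b \<and> q x = 0"
proof -
  have dec: "q y < q x" if "a < x" "x < y" "y < b" for x y
  proof (rule DERIV_neg_imp_decreasing[OF that(2)])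
    fix z assume "x \<le> z" "z \<le> y"
    then have "\<exists>d<0. (q has_real_derivative d) (at z)" using that by (intro deriv) auto
    then show "\<exists>d. (q has_real_derivative d) (at z) \<and> d < 0" by blast
  qed
  obtain d where d: "d > a" "\<And>x. a < x \<Longrightarrow> x < d \<Longrightarrow> q x > 0"
    using right unfolding eventually_at_right_field by blast
  obtain c where c: "c < b" "\<And>x. c < x \<Longrightarrow> x < b \<Longrightarrow> q x < 0"
    using left unfolding eventually_at_left_field by blast
  obtain s where s: "a < s" "s < min d b" using d(1) \<open>a < b\<close> by (metis dense min_less_iff_conj)
  obtain t where t: "max s c < t" "t < b" using c(1) s by (metis dense max_less_iff_conj min_less_iff_conj)
  have "continuous_on {s..t} q"
  proof (intro continuous_at_imp_continuous_on ballI)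
    fix x assume "x \<in> {s..t}"
    then have "\<exists>d<0. (q has_real_derivative d) (at x)" using s t by (intro deriv) auto
    then show "isCont q x" using DERIV_isCont by blast
  qed
  moreover have "q s > 0" "q t < 0" using s t c d by auto
  ultimately obtain x where "s \<le> x" "x \<le> t" "q x = 0"
    using IVT2'[of q t 0 s] t by force
  then have "a < x \<and> x < b \<and> q x = 0" using s t by auto
  then show ?thesis using dec by (metis less_irrefl linorder_neqE_linordered_idom)
qed

lemma zeros_poles_interlace:
  fixes q :: "real \<Rightarrow> real" and Z :: "real set"
  assumes pos: "\<And>z. z \<in> Z \<Longrightarrow> z > 0"
    and fin: "\<And>b. finite (Z \<inter> {..b})" and unb: "\<And>b. \<exists>z\<in>Z. z > b"
    and deriv: "\<And>x. x > 0 \<Longrightarrow> x \<notin> Z \<Longrightarrow> \<exists>d<0. (q has_real_derivative d) (at x)"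
    and right: "\<And>z. z \<in> Z \<Longrightarrow> \<forall>\<^sub>F x in at_right z. q x > 0"
    and left: "\<And>z. z \<in> Z \<Longrightarrow> \<forall>\<^sub>F x in at_left z. q x < 0"
    and zero: "\<forall>\<^sub>F x in at_right 0. q x > 0"
  shows "\<exists>j w. increasing_enumeration {x. x > 0 \<and> x \<notin> Z \<and> q x = 0} j
           \<and> increasing_enumeration Z w \<and> 0 < j 0 \<and> (\<forall>l. j l < w l \<and> w l < j (Suc l))"
proof -
  obtain w where w: "increasing_enumeration Z w"
    and gap: "\<And>l y. y \<in> Z \<Longrightarrow> y < w (Suc l) \<Longrightarrow> y \<le> w l"
    and first: "\<And>y. y \<in> Z \<Longrightarrow> w 0 \<le> y"
    using increasing_enumeration_exists[OF fin unb] by blast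
  have mono: "strict_mono w" and Z: "Z = range w"
    using w by (auto simp: increasing_enumeration_def)
  \<comment> \<open>\<open>p l\<close> is the left end of the pole-free interval that ends at
    \<open>w l\<close>; the origin plays the pole before \<open>w 0\<close>.\<close>
  define p where "p l = (case l of 0 \<Rightarrow> 0 | Suc k \<Rightarrow> w k)" for l
  have p0: "p 0 = 0" and pS: "p (Suc l) = w l" for l by (simp_all add: p_def)
  have wpos: "w l > 0" for l using pos Z by auto
  have plt: "p l < w l" for l
    by (cases l) (use mono wpos in \<open>auto simp: p0 pS strict_mono_Suc_iff\<close>)
  have p_nonneg: "p l \<ge> 0" for l by (cases l) (use wpos in \<open>auto simp: p0 pS less_imp_le\<close>)
  have notZ: "x \<notin> Z" if "p l < x" "x < w l" for x l
  proof (cases l)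
    case 0
    then show ?thesis using first[of x] that by auto
  next
    case (Suc k)
    then show ?thesis using gap[of x k] that by (auto simp: pS)
  qed
  have uniq: "\<exists>!x. p l < x \<and> x < w l \<and> q x = 0" for l
  proof (rule decreasing_unique_zero[OF plt])
    fix x assume x: "p l < x" "x < w l"
    then have "x > 0" using p_nonneg[of l] by linarith
    then show "\<exists>d<0. (q has_real_derivative d) (at x)" using deriv notZ x by blast
  next
    show "\<forall>\<^sub>F x in at_right (p l). q x > 0"
      by (cases l) (use zero right Z in \<open>auto simp: p0 pS\<close>)
    show "\<forall>\<^sub>F x in at_left (w l). q x < 0" using left Z by auto
  qed
  then obtain j where j: "\<And>l. p l < j l" "\<And>l. j l < w l" "\<And>l. q (j l) = 0"
    by metis
  have jS: "w l < j (Suc l)" for l using j(1)[of "Suc l"] by (simp add: pS)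
  have jmono: "strict_mono j" unfolding strict_mono_Suc_iff using j(2) jS less_trans by blast
  have "\<exists>l. x = j l" if x: "x > 0" "x \<notin> Z" "q x = 0" for x
  proof -
    \<comment> \<open>The least pole above \<open>x\<close> identifies the interval containing
      \<open>x\<close>, whose only zero is \<open>j l\<close>.\<close>
    define l where "l = (LEAST l. x < w l)"
    have "\<exists>l. x < w l" using unb[of x] Z by auto
    then have l: "x < w l" unfolding l_def by (rule LeastI_ex)
    have "p l < x"
    proof (cases l)
      case 0
      then show ?thesis using x by (simp add: p0)
    next
      case (Suc k)
      then have "\<not> x < w k" using not_less_Least[of k "\<lambda>l. x < w l"] l_def by simp
      moreover have "x \<noteq> w k" using x Z by auto
      ultimately show ?thesis using Suc by (simp add: pS)
    qed
    then show ?thesis using l x j uniq by blast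
  qed
  moreover have "j l > 0" "j l \<notin> Z" for l
    using j[of l] p_nonneg[of l] notZ by (auto intro: le_less_trans)
  ultimately have "increasing_enumeration {x. x > 0 \<and> x \<notin> Z \<and> q x = 0} j"
    using jmono j(3) by (auto simp: increasing_enumeration_def)
  moreover have "0 < j 0" using j(1)[of 0] p0 by simp
  ultimately show ?thesis using w j(2) jS by (intro exI[of _ j] exI[of _ w]) simp
qed

text \<open>Where \<open>D\<close> vanishes, the Wronskian condition reduces to
  \<open>N z * D' > 0\<close>. Hence \<open>D\<close>, multiplied by the constant
  \<open>N z\<close>, increases through 0 whatever the sign of \<open>N z\<close>, and this fixes
  the sign of the pole on each side.\<close>

lemma quotient_pole_sides:
  fixes N D :: "real \<Rightarrow> real"
  assumes N: "(N has_real_derivative N') (at z)" and D: "(D has_real_derivative D') (at z)"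
    and wronskian: "N' * D z - N z * D' < 0" and "D z = 0"
  shows "filterlim (\<lambda>x. N x / D x) at_top (at_right z)"
    and "filterlim (\<lambda>x. N x / D x) at_bot (at_left z)"
proof -
  define g where "g x = D x * N z" for x
  have g: "(g has_real_derivative D' * N z) (at z)"
    unfolding g_def by (rule DERIV_cmult_right[OF D])
  have g0: "g z = 0" and g': "D' * N z > 0" using assms by (auto simp: g_def mult.commute)
  then have nz: "N z * N z > 0" by (auto simp: zero_less_mult_iff)
  have glim: "(g \<longlongrightarrow> 0) (at z within S)" for S
    using DERIV_isCont[OF g] g0 by (metis continuous_at_imp_continuous_within continuous_within)
  have Nlim: "((\<lambda>x. N x * N z) \<longlongrightarrow> N z * N z) (at z within S)" for S
    using DERIV_isCont[OF N]
    by (intro tendsto_intros) (metis continuous_at_imp_continuous_within continuous_within)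
  have "N z \<noteq> 0" using nz by auto
  \<comment> \<open>This holds at zeros of \<open>D\<close> too, since both sides are then 0 by the
    convention for division by 0.\<close>
  then have eq: "(\<lambda>x. N x / D x) = (\<lambda>x. N x * N z * inverse (g x))"
    by (intro ext) (simp add: g_def divide_inverse)
  obtain d where d: "d > 0" "\<And>h. h > 0 \<Longrightarrow> h < d \<Longrightarrow> g z < g (z + h)"
    using DERIV_pos_inc_right[OF g g'] by blast
  have "g x > 0" if "z < x" "x < z + d" for x using d(2)[of "x - z"] that g0 by simp
  then have "\<forall>\<^sub>F x in at_right z. g x > 0"
    using d(1) unfolding eventually_at_right_field by (intro exI[of _ "z + d"]) auto
  then have "filterlim (\<lambda>x. inverse (g x)) at_top (at_right z)"
    using glim by (intro filterlim_inverse_at_top)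
  then show "filterlim (\<lambda>x. N x / D x) at_top (at_right z)"
    unfolding eq by (rule filterlim_tendsto_pos_mult_at_top[OF Nlim nz])
  obtain d where d: "d > 0" "\<And>h. h > 0 \<Longrightarrow> h < d \<Longrightarrow> g (z - h) < g z"
    using DERIV_pos_inc_left[OF g g'] by blast
  have "g x < 0" if "z - d < x" "x < z" for x using d(2)[of "z - x"] that g0 by simp
  then have "\<forall>\<^sub>F x in at_left z. g x < 0"
    using d(1) unfolding eventually_at_left_field by (intro exI[of _ "z - d"]) auto
  then have "filterlim (\<lambda>x. inverse (g x)) at_bot (at_left z)"
    using glim by (intro filterlim_inverse_at_bot)
  then show "filterlim (\<lambda>x. N x / D x) at_bot (at_left z)"
    unfolding eq by (rule filterlim_tendsto_pos_mult_at_bot[OF Nlim nz])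
qed

text \<open>Infinitely many zeros in a compact interval accumulate at some \<open>z\<close>. By
  continuity \<open>f z = 0\<close>, and the difference quotients at \<open>z\<close> vanish
  arbitrarily close to it, which contradicts \<open>f' z \<noteq> 0\<close>.\<close>

lemma finite_zeros_of_nonzero_derivative:
  fixes f :: "real \<Rightarrow> real"
  assumes "a > 0"
    and deriv: "\<And>x. x \<ge> a \<Longrightarrow> (f has_real_derivative f' x) (at x)"
    and simple: "\<And>x. x \<ge> a \<Longrightarrow> f x = 0 \<Longrightarrow> f' x \<noteq> 0"
  shows "finite {x. a \<le> x \<and> x \<le> b \<and> f x = 0}"
proof (rule ccontr)
  let ?Z = "{x. a \<le> x \<and> x \<le> b \<and> f x = 0}"
  assume "infinite ?Z"
  moreover have "?Z \<subseteq> {a..b}" by auto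
  ultimately obtain z where z: "z \<in> {a..b}" "z islimpt ?Z"
    using Heine_Borel_imp_Bolzano_Weierstrass[of "{a..b}" ?Z] by auto
  then have d: "(f has_real_derivative f' z) (at z)" and "a \<le> z" using deriv by auto
  have freq: "\<exists>\<^sub>F x in at z. f x = 0"
    using z(2) unfolding islimpt_conv_frequently_at by (rule frequently_mono[rotated]) auto
  have fz: "f z = 0"
  proof (rule ccontr)
    assume "f z \<noteq> 0"
    then have "\<forall>\<^sub>F x in at z. f x \<noteq> 0"
      using DERIV_isCont[OF d] by (intro tendsto_imp_eventually_ne) (auto simp: isCont_def)
    then show False using freq by (simp add: frequently_def)
  qed
  have "((\<lambda>x. (f x - f z) / (x - z)) \<longlongrightarrow> f' z) (at z)"
    using d by (simp add: has_field_derivative_iff)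
  then have "\<forall>\<^sub>F x in at z. (f x - f z) / (x - z) \<noteq> 0"
    using simple[OF \<open>a \<le> z\<close> fz] by (rule tendsto_imp_eventually_ne)
  then have "\<forall>\<^sub>F x in at z. f x \<noteq> 0" by (rule eventually_mono) (simp add: fz)
  then show False using freq by (simp add: frequently_def)
qed

text \<open>
  At a zero of \<open>D1 * D2\<close> both quotients are monotone, so neither can cancel the pole of the other.
\<close>
lemma zeros_poles_of_decreasing_quotients_interlace:
  fixes N1 D1 N2 D2 :: "real \<Rightarrow> real"
  assumes N1: "\<And>x. x > 0 \<Longrightarrow> (N1 has_real_derivative N1' x) (at x)"
    and D1: "\<And>x. x > 0 \<Longrightarrow> (D1 has_real_derivative D1' x) (at x)"
    and N2: "\<And>x. x > 0 \<Longrightarrow> (N2 has_real_derivative N2' x) (at x)"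
    and D2: "\<And>x. x > 0 \<Longrightarrow> (D2 has_real_derivative D2' x) (at x)"
    and W1: "\<And>x. x > 0 \<Longrightarrow> N1' x * D1 x - N1 x * D1' x < 0"
    and W2: "\<And>x. x > 0 \<Longrightarrow> N2' x * D2 x - N2 x * D2' x < 0"
    and zero1: "\<forall>\<^sub>F x in at_right 0. D1 x \<noteq> 0"
    and zero2: "\<forall>\<^sub>F x in at_right 0. D2 x \<noteq> 0"
    and zero: "\<forall>\<^sub>F x in at_right 0. N1 x / D1 x + N2 x / D2 x > 0"
    and unb: "\<And>b. \<exists>z>b. D1 z * D2 z = 0"
  defines "Z \<equiv> {x. x > 0 \<and> D1 x * D2 x = 0}"
  shows "\<exists>j w. increasing_enumeration {x. x > 0 \<and> x \<notin> Z \<and> N1 x / D1 x + N2 x / D2 x = 0} j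
           \<and> increasing_enumeration Z w \<and> 0 < j 0 \<and> (\<forall>l. j l < w l \<and> w l < j (Suc l))"
proof (rule zeros_poles_interlace)
  have simple: "D1 x = 0 \<Longrightarrow> D1' x \<noteq> 0" "D2 x = 0 \<Longrightarrow> D2' x \<noteq> 0" if "x > 0" for x
    using W1[OF that] W2[OF that] by auto
  \<comment> \<open>No denominator vanishes in \<open>(0, e)\<close>, so \<open>Z\<close> starts at
    \<open>e\<close> or later, away from the origin, where no derivatives are assumed.\<close>
  obtain e where e: "e > 0" "\<And>x. 0 < x \<Longrightarrow> x < e \<Longrightarrow> D1 x \<noteq> 0 \<and> D2 x \<noteq> 0"
    using eventually_conj[OF zero1 zero2] unfolding eventually_at_right_field by blast
  fix b :: real
  have "Z \<inter> {..b} \<subseteq> {x. e \<le> x \<and> x \<le> b \<and> D1 x = 0} \<union> {x. e \<le> x \<and> x \<le> b \<and> D2 x = 0}"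
    unfolding Z_def using e(2) not_less by auto
  moreover have "finite {x. e \<le> x \<and> x \<le> b \<and> D1 x = 0}" "finite {x. e \<le> x \<and> x \<le> b \<and> D2 x = 0}"
    using e(1) simple
    by (auto intro!: finite_zeros_of_nonzero_derivative D1 D2)
  ultimately show "finite (Z \<inter> {..b})" by (meson finite_UnI finite_subset)
  obtain z where "z > max b 0" "D1 z * D2 z = 0" using unb by blast
  then show "\<exists>z\<in>Z. b < z" unfolding Z_def by auto
next
  fix x :: real assume "x > 0" "x \<notin> Z"
  then have x: "x > 0" "D1 x \<noteq> 0" "D2 x \<noteq> 0" by (auto simp: Z_def)
  have "((\<lambda>x. N1 x / D1 x + N2 x / D2 x) has_real_derivative
      (N1' x * D1 x - N1 x * D1' x) / (D1 x * D1 x) + (N2' x * D2 x - N2 x * D2' x) / (D2 x * D2 x)) (at x)"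
    using x by (intro DERIV_add DERIV_divide N1 N2 D1 D2)
  moreover have "(N1' x * D1 x - N1 x * D1' x) / (D1 x * D1 x) < 0"
    "(N2' x * D2 x - N2 x * D2' x) / (D2 x * D2 x) < 0"
    using W1[OF x(1)] W2[OF x(1)] x by (auto simp: divide_less_0_iff zero_less_mult_iff)
  ultimately show "\<exists>d<0. ((\<lambda>x. N1 x / D1 x + N2 x / D2 x) has_real_derivative d) (at x)"
    by (meson add_neg_neg)
next
  fix z assume "z \<in> Z"
  then have z: "z > 0" "D1 z = 0 \<or> D2 z = 0" by (auto simp: Z_def)
  note p1 = quotient_pole_sides[OF N1 D1 W1, OF z(1) z(1) z(1)]
  note p2 = quotient_pole_sides[OF N2 D2 W2, OF z(1) z(1) z(1)]
  have c1: "((\<lambda>x. N1 x / D1 x) \<longlongrightarrow> N1 z / D1 z) (at z within S)" if "D1 z \<noteq> 0" for S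
    using that DERIV_isCont[OF N1[OF z(1)]] DERIV_isCont[OF D1[OF z(1)]]
    by (intro tendsto_intros) (metis continuous_at_imp_continuous_within continuous_within)+
  have c2: "((\<lambda>x. N2 x / D2 x) \<longlongrightarrow> N2 z / D2 z) (at z within S)" if "D2 z \<noteq> 0" for S
    using that DERIV_isCont[OF N2[OF z(1)]] DERIV_isCont[OF D2[OF z(1)]]
    by (intro tendsto_intros) (metis continuous_at_imp_continuous_within continuous_within)+
  show "\<forall>\<^sub>F x in at_right z. N1 x / D1 x + N2 x / D2 x > 0"
  \<comment> \<open>At a common zero both quotients blow up with the same sign; otherwise one has a
    pole and the other converges.\<close>
  proof (cases "D1 z = 0 \<and> D2 z = 0")
    case True
    then have "\<forall>\<^sub>F x in at_right z. N1 x / D1 x > 0" "\<forall>\<^sub>F x in at_right z. N2 x / D2 x > 0"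
      using p1(1) p2(1) by (simp_all add: filterlim_at_top_dense)
    then show ?thesis by eventually_elim (rule add_pos_pos)
  next
    case False
    then have "filterlim (\<lambda>x. N1 x / D1 x + N2 x / D2 x) at_top (at_right z)"
      using z(2) c1[of "{z<..}"] c2[of "{z<..}"] p1(1) p2(1)
        filterlim_tendsto_add_at_top_iff[of "\<lambda>x. N1 x / D1 x" "N1 z / D1 z" "at_right z" "\<lambda>x. N2 x / D2 x"]
        filterlim_tendsto_add_at_top_iff[of "\<lambda>x. N2 x / D2 x" "N2 z / D2 z" "at_right z" "\<lambda>x. N1 x / D1 x"]
      by (auto simp: add.commute)
    then show ?thesis by (simp add: filterlim_at_top_dense)
  qed
  show "\<forall>\<^sub>F x in at_left z. N1 x / D1 x + N2 x / D2 x < 0"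
  proof (cases "D1 z = 0 \<and> D2 z = 0")
    case True
    then have "\<forall>\<^sub>F x in at_left z. N1 x / D1 x < 0" "\<forall>\<^sub>F x in at_left z. N2 x / D2 x < 0"
      using p1(2) p2(2) by (simp_all add: filterlim_at_bot_dense)
    then show ?thesis by eventually_elim (rule add_neg_neg)
  next
    case False
    then have "filterlim (\<lambda>x. N1 x / D1 x + N2 x / D2 x) at_bot (at_left z)"
      using z(2) c1[of "{..<z}"] c2[of "{..<z}"] p1(2) p2(2)
        filterlim_tendsto_add_at_bot_iff[of "\<lambda>x. N1 x / D1 x" "N1 z / D1 z" "at_left z" "\<lambda>x. N2 x / D2 x"]
        filterlim_tendsto_add_at_bot_iff[of "\<lambda>x. N2 x / D2 x" "N2 z / D2 z" "at_left z" "\<lambda>x. N1 x / D1 x"]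
      by (auto simp: add.commute)
    then show ?thesis by (simp add: filterlim_at_bot_dense)
  qed
qed (use zero Z_def in auto)

section \<open>Bessel functions of positive order\<close>

definition bessel_coeff :: "real \<Rightarrow> nat \<Rightarrow> real" where
  "bessel_coeff \<mu> k = (-1) ^ k * rGamma (\<mu> + real k + 1) / fact k"

text \<open>This is the Bessel-Clifford function of order \<open>\<mu>\<close> at \<open>-t\<close>:
  what remains of the Bessel function after removing the factor \<open>(x / 2) powr \<mu>\<close>,
  with \<open>t = (x / 2)^2\<close>. Being a power series, it can be evaluated and differentiated at
  0.\<close>

definition bessel_entire :: "real \<Rightarrow> real \<Rightarrow> real" where
  "bessel_entire \<mu> t = (\<Sum>k. bessel_coeff \<mu> k * t ^ k)"

text \<open>Raising \<open>k\<close> by one divides by \<open>\<mu> + real k + 1\<close>, which is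
  at least 1. The bound, uniform in \<open>k\<close>, lets the exponential series dominate the
  Bessel series.\<close>

lemma rGamma_shift_bounds:
  assumes "\<mu> \<ge> (0::real)"
  shows "0 < rGamma (\<mu> + real k + 1)" "rGamma (\<mu> + real k + 1) \<le> rGamma (\<mu> + 1)"
proof -
  show pos: "0 < rGamma (\<mu> + real k + 1)" for k
    using assms by (simp add: rGamma_inverse_Gamma Gamma_real_pos)
  show "rGamma (\<mu> + real k + 1) \<le> rGamma (\<mu> + 1)"
  proof (induction k)
    case (Suc k)
    have "(\<mu> + real k + 1) * rGamma (\<mu> + real k + 1 + 1) = rGamma (\<mu> + real k + 1)"
      by (rule rGamma_plus1)
    moreover have "1 * rGamma (\<mu> + real k + 1 + 1) \<le> (\<mu> + real k + 1) * rGamma (\<mu> + real k + 1 + 1)"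
      using assms pos[of "Suc k"] by (intro mult_right_mono) (auto simp: ac_simps)
    ultimately show ?case using Suc by (simp add: ac_simps)
  qed simp
qed

lemma summable_bessel_coeff:
  assumes "\<mu> \<ge> 0"
  shows "summable (\<lambda>k. bessel_coeff \<mu> k * t ^ k)"
proof (rule summable_comparison_test')
  show "summable (\<lambda>k. rGamma (\<mu> + 1) * (\<bar>t\<bar> ^ k / fact k))"
    using summable_exp[of "\<bar>t\<bar>"] by (intro summable_mult) (simp add: field_simps)
  fix k
  show "norm (bessel_coeff \<mu> k * t ^ k) \<le> rGamma (\<mu> + 1) * (\<bar>t\<bar> ^ k / fact k)"
    using rGamma_shift_bounds[OF assms, of k]
    by (simp add: bessel_coeff_def abs_mult power_abs divide_right_mono mult_right_mono)
qed

text \<open>The factor \<open>Suc k\<close> cancels in the factorial, and the shifted argument of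
  \<open>rGamma\<close> belongs to the next order: differentiation raises the order by one.\<close>

lemma diffs_bessel_coeff: "diffs (bessel_coeff \<mu>) = (\<lambda>k. - bessel_coeff (\<mu> + 1) k)"
proof
  fix k
  have "\<mu> + real (Suc k) + 1 = \<mu> + 1 + real k + 1" by simp
  then show "diffs (bessel_coeff \<mu>) k = - bessel_coeff (\<mu> + 1) k"
    by (simp only: diffs_def bessel_coeff_def fact_Suc power_Suc of_nat_mult) (simp del: of_nat_Suc)
qed

lemma DERIV_bessel_entire:
  assumes "\<mu> \<ge> 0"
  shows "(bessel_entire \<mu> has_real_derivative - bessel_entire (\<mu> + 1) t) (at t)"
proof -
  have "((\<lambda>t. \<Sum>k. bessel_coeff \<mu> k * t ^ k) has_real_derivative
      (\<Sum>k. diffs (bessel_coeff \<mu>) k * t ^ k)) (at t)"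
    by (rule termdiffs_strong_converges_everywhere) (rule summable_bessel_coeff[OF assms])
  then show ?thesis
    using summable_bessel_coeff[of "\<mu> + 1" t] assms
    by (simp add: bessel_entire_def[abs_def] diffs_bessel_coeff suminf_minus)
qed

text \<open>By the functional equation of \<open>rGamma\<close>, a coefficient of order
  \<open>\<mu>\<close> is \<open>\<mu> + 1 + k\<close> times that of order \<open>\<mu> + 1\<close>.
  The factor \<open>k\<close> amounts to applying \<open>t * d/dt\<close>, which produces order
  \<open>\<mu> + 2\<close>.\<close>

lemma bessel_entire_recurrence:
  assumes "\<mu> \<ge> 0"
  shows "bessel_entire \<mu> t = (\<mu> + 1) * bessel_entire (\<mu> + 1) t - t * bessel_entire (\<mu> + 2) t"
proof -
  let ?c = "bessel_coeff (\<mu> + 1)"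
  have s1: "(\<lambda>k. (\<mu> + 1) * (?c k * t ^ k)) sums ((\<mu> + 1) * bessel_entire (\<mu> + 1) t)"
    unfolding bessel_entire_def using assms by (intro sums_mult summable_sums summable_bessel_coeff) simp
  have sd: "summable (\<lambda>k. diffs ?c k * t ^ k)"
    using summable_minus[OF summable_bessel_coeff[of "\<mu> + 2" t]] assms
    by (simp add: diffs_bessel_coeff add.assoc)
  have "(\<lambda>k. of_nat k * ?c k * t ^ (k - Suc 0)) sums (\<Sum>k. diffs ?c k * t ^ k)"
    using diffs_equiv[OF sd] .
  also have "(\<Sum>k. diffs ?c k * t ^ k) = - bessel_entire (\<mu> + 2) t"
    using summable_bessel_coeff[of "\<mu> + 2" t] assms
    by (simp add: bessel_entire_def diffs_bessel_coeff add.assoc suminf_minus)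
  finally have "(\<lambda>k. t * (of_nat k * ?c k * t ^ (k - Suc 0))) sums (t * - bessel_entire (\<mu> + 2) t)"
    by (rule sums_mult)
  \<comment> \<open>At \<open>k = 0\<close> the exponent is truncated to 0, but the factor
    \<open>of_nat k\<close> removes the term.\<close>
  also have "(\<lambda>k. t * (of_nat k * ?c k * t ^ (k - Suc 0))) = (\<lambda>k. of_nat k * (?c k * t ^ k))"
    by (rule ext) (case_tac k, simp_all)
  finally have "(\<lambda>k. (\<mu> + 1) * (?c k * t ^ k) + of_nat k * (?c k * t ^ k)) sums
      ((\<mu> + 1) * bessel_entire (\<mu> + 1) t + t * - bessel_entire (\<mu> + 2) t)"
    using s1 by (intro sums_add)
  moreover have "(\<mu> + 1) * (?c k * t ^ k) + of_nat k * (?c k * t ^ k) = bessel_coeff \<mu> k * t ^ k" for k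
  proof -
    have "rGamma (\<mu> + real k + 1) = (\<mu> + real k + 1) * rGamma (\<mu> + 1 + real k + 1)"
      using rGamma_plus1[of "\<mu> + real k + 1"] by (simp add: ac_simps)
    then have "bessel_coeff \<mu> k = (\<mu> + real k + 1) * ?c k" by (simp add: bessel_coeff_def)
    then show ?thesis by (simp add: algebra_simps)
  qed
  ultimately show ?thesis unfolding bessel_entire_def[of \<mu>] by (simp add: sums_iff)
qed

lemma bessel_J_eq_entire:
  assumes "\<mu> \<ge> 0" "x > 0"
  shows "bessel_J \<mu> x = (x / 2) powr \<mu> * bessel_entire \<mu> ((x / 2)\<^sup>2)"
proof -
  have "(x / 2) powr (2 * real k + \<mu>) = (x / 2) powr \<mu> * ((x / 2)\<^sup>2) ^ k" for k
  proof -
    have "(x / 2) powr (2 * real k) = (x / 2) ^ (2 * k)"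
      using assms powr_realpow[of "x / 2" "2 * k"] by simp
    then show ?thesis by (simp add: powr_add power_mult)
  qed
  then have "bessel_J \<mu> x = (\<Sum>k. (x / 2) powr \<mu> * (bessel_coeff \<mu> k * ((x / 2)\<^sup>2) ^ k))"
    by (simp add: bessel_J_def bessel_coeff_def ac_simps)
  also have "\<dots> = (x / 2) powr \<mu> * bessel_entire \<mu> ((x / 2)\<^sup>2)"
    unfolding bessel_entire_def using summable_bessel_coeff[OF assms(1)] by (rule suminf_mult)
  finally show ?thesis .
qed

lemma bessel_J_recurrence:
  assumes "\<mu> \<ge> 0" "x > 0"
  shows "bessel_J (\<mu> + 2) x = 2 * (\<mu> + 1) / x * bessel_J (\<mu> + 1) x - bessel_J \<mu> x"
proof -
  have "(x / 2) powr (\<mu> + 1) = (x / 2) powr \<mu> * (x / 2)"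
    "(x / 2) powr (\<mu> + 2) = (x / 2) powr \<mu> * (x / 2)\<^sup>2"
    using assms by (simp_all add: powr_add)
  then have J1: "bessel_J (\<mu> + 1) x = (x / 2) powr \<mu> * (x / 2) * bessel_entire (\<mu> + 1) ((x / 2)\<^sup>2)"
    and J2: "bessel_J (\<mu> + 2) x = (x / 2) powr \<mu> * (x / 2)\<^sup>2 * bessel_entire (\<mu> + 2) ((x / 2)\<^sup>2)"
    using assms by (simp_all only: bessel_J_eq_entire add_nonneg_nonneg zero_le_numeral zero_le_one)
  have J0: "bessel_J \<mu> x = (x / 2) powr \<mu> *
      ((\<mu> + 1) * bessel_entire (\<mu> + 1) ((x / 2)\<^sup>2) - (x / 2)\<^sup>2 * bessel_entire (\<mu> + 2) ((x / 2)\<^sup>2))"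
    using assms by (simp only: bessel_J_eq_entire bessel_entire_recurrence[of \<mu>])
  show ?thesis unfolding J0 J1 J2 using assms(2) by (simp add: field_simps power2_eq_square)
qed

lemma DERIV_bessel_J:
  assumes "\<mu> \<ge> 0" "x > 0"
  shows "(bessel_J \<mu> has_real_derivative \<mu> / x * bessel_J \<mu> x - bessel_J (\<mu> + 1) x) (at x)"
proof -
  have "((\<lambda>x. (x / 2) powr \<mu> * bessel_entire \<mu> ((x / 2)\<^sup>2)) has_real_derivative
      \<mu> / x * bessel_J \<mu> x - bessel_J (\<mu> + 1) x) (at x)"
    using assms
    by (auto intro!: derivative_eq_intros DERIV_chain2[OF DERIV_bessel_entire]
        simp: bessel_J_eq_entire powr_add powr_diff field_simps power2_eq_square)
  then show ?thesis
    by (rule has_field_derivative_transform_within_open[where S = "{0<..}"])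
      (use assms in \<open>auto simp: bessel_J_eq_entire\<close>)
qed

text \<open>Lowering the order here, while \<open>DERIV_bessel_J\<close> raises it, makes the orders
  \<open>\<mu>\<close> and \<open>\<mu> + 1\<close> a closed linear system of differential
  equations.\<close>

lemma DERIV_bessel_J_Suc:
  assumes "\<mu> \<ge> 0" "x > 0"
  shows "(bessel_J (\<mu> + 1) has_real_derivative bessel_J \<mu> x - (\<mu> + 1) / x * bessel_J (\<mu> + 1) x) (at x)"
proof -
  have "(\<mu> + 1) / x * bessel_J (\<mu> + 1) x - bessel_J (\<mu> + 2) x = bessel_J \<mu> x - (\<mu> + 1) / x * bessel_J (\<mu> + 1) x"
    using bessel_J_recurrence[OF assms] by (simp add: field_simps)
  moreover have "\<mu> + 1 + 1 = \<mu> + 2" by simp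
  ultimately show ?thesis using DERIV_bessel_J[of "\<mu> + 1" x] assms by (metis add_nonneg_nonneg zero_le_one)
qed

section \<open>Behaviour near the origin, positivity and existence of zeros\<close>

lemma bessel_entire_tendsto_at_right_0:
  assumes "\<mu> \<ge> 0"
  shows "((\<lambda>x. bessel_entire \<mu> ((x / 2)\<^sup>2)) \<longlongrightarrow> rGamma (\<mu> + 1)) (at_right 0)"
proof -
  have "isCont (\<lambda>x. bessel_entire \<mu> ((x / 2)\<^sup>2)) 0"
    by (rule isCont_o2[OF _ DERIV_isCont[OF DERIV_bessel_entire[OF assms]]]) simp
  moreover have "bessel_entire \<mu> 0 = rGamma (\<mu> + 1)"
    by (simp add: bessel_entire_def powser_zero) (simp add: bessel_coeff_def)
  ultimately show ?thesis by (auto simp: isCont_def intro: tendsto_within_subset)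
qed

lemma bessel_J_pos_at_right_0:
  assumes "\<mu> \<ge> 0"
  shows "\<forall>\<^sub>F x in at_right 0. bessel_J \<mu> x > 0"
proof -
  have "\<forall>\<^sub>F x in at_right 0. bessel_entire \<mu> ((x / 2)\<^sup>2) > 0"
    using bessel_entire_tendsto_at_right_0[OF assms] rGamma_shift_bounds(1)[OF assms, of 0]
    by (intro order_tendstoD) auto
  moreover have "\<forall>\<^sub>F x::real in at_right 0. x > 0" by (rule eventually_at_right_less)
  ultimately show ?thesis
    by eventually_elim (use assms in \<open>simp add: bessel_J_eq_entire\<close>)
qed

lemma bessel_J_tendsto_at_right_0:
  assumes "\<mu> > 0"
  shows "(bessel_J \<mu> \<longlongrightarrow> 0) (at_right 0)"
proof -
  have "((\<lambda>x::real. (x / 2) powr \<mu>) \<longlongrightarrow> 0) (at_right 0)"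
  proof (rule tendsto_zero_powrI)
    show "((\<lambda>x::real. x / 2) \<longlongrightarrow> 0) (at_right 0)" by (intro tendsto_eq_intros) auto
    show "\<forall>\<^sub>F x::real in at_right 0. 0 \<le> x / 2"
      using eventually_at_right_less[of "0::real"] by eventually_elim simp
  qed (use assms in auto)
  then have "((\<lambda>x. (x / 2) powr \<mu> * bessel_entire \<mu> ((x / 2)\<^sup>2)) \<longlongrightarrow> 0 * rGamma (\<mu> + 1)) (at_right 0)"
    using assms by (intro tendsto_mult bessel_entire_tendsto_at_right_0) auto
  moreover have "\<forall>\<^sub>F x in at_right 0. (x / 2) powr \<mu> * bessel_entire \<mu> ((x / 2)\<^sup>2) = bessel_J \<mu> x"
    using eventually_at_right_less[of "0::real"]
    by eventually_elim (use assms in \<open>simp add: bessel_J_eq_entire\<close>)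
  ultimately show ?thesis by (simp add: tendsto_cong)
qed

lemma bessel_J_quotient_tendsto_at_right_0:
  assumes "\<mu> \<ge> 0"
  shows "((\<lambda>x. bessel_J (\<mu> + 1) x / bessel_J \<mu> x) \<longlongrightarrow> 0) (at_right 0)"
proof -
  have "((\<lambda>x::real. x / 2) \<longlongrightarrow> 0) (at_right 0)" by (intro tendsto_eq_intros) auto
  then have "((\<lambda>x. x / 2 * (bessel_entire (\<mu> + 1) ((x / 2)\<^sup>2) / bessel_entire \<mu> ((x / 2)\<^sup>2)))
      \<longlongrightarrow> 0 * (rGamma (\<mu> + 1 + 1) / rGamma (\<mu> + 1))) (at_right 0)"
    using assms rGamma_shift_bounds(1)[OF assms, of 0]
    by (intro tendsto_mult tendsto_divide bessel_entire_tendsto_at_right_0) auto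
  moreover have "\<forall>\<^sub>F x in at_right 0. x / 2 * (bessel_entire (\<mu> + 1) ((x / 2)\<^sup>2) / bessel_entire \<mu> ((x / 2)\<^sup>2))
      = bessel_J (\<mu> + 1) x / bessel_J \<mu> x"
    using eventually_at_right_less[of "0::real"]
    by eventually_elim (use assms in \<open>simp add: bessel_J_eq_entire powr_add\<close>)
  ultimately show ?thesis by (simp add: tendsto_cong)
qed

text \<open>
  The left-hand side, times \<open>x\<^sup>2\<close>, has the derivative
  \<open>x * ((bessel_J \<mu> x)\<^sup>2 + (bessel_J (\<mu> + 1) x)\<^sup>2)\<close> and tends to \<open>0\<close> at \<open>0\<close>.
\<close>
lemma bessel_J_consecutive_form_pos:
  assumes "\<mu> > 0" "x > 0"
  shows "(bessel_J \<mu> x)\<^sup>2 + (bessel_J (\<mu> + 1) x)\<^sup>2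
    - (2 * \<mu> + 1) / x * (bessel_J \<mu> x * bessel_J (\<mu> + 1) x) > 0"
proof -
  define u v where "u = bessel_J \<mu>" and "v = bessel_J (\<mu> + 1)"
  have du: "(u has_real_derivative \<mu> / t * u t - v t) (at t)"
    and dv: "(v has_real_derivative u t - (\<mu> + 1) / t * v t) (at t)" if "t > 0" for t
    using DERIV_bessel_J[of \<mu> t] DERIV_bessel_J_Suc[of \<mu> t] assms that
    unfolding u_def v_def by simp_all
  define F where "F x = x\<^sup>2 * ((u x)\<^sup>2 + (v x)\<^sup>2) - (2 * \<mu> + 1) * x * (u x * v x)" for x
  have deriv: "(F has_real_derivative t * ((u t)\<^sup>2 + (v t)\<^sup>2)) (at t)" if "t > 0" for t
    unfolding F_def using that
    by (auto intro!: derivative_eq_intros du dv simp: field_simps power2_eq_square)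
  have mono: "F s \<le> F t" if "0 < s" "s \<le> t" for s t
  proof (rule DERIV_nonneg_imp_nondecreasing[of _ _ F])
    fix y assume "s \<le> y"
    then have y: "y > 0" using that by simp
    then have "y * ((u y)\<^sup>2 + (v y)\<^sup>2) \<ge> 0" by simp
    then show "\<exists>d. (F has_real_derivative d) (at y) \<and> 0 \<le> d" using deriv[OF y] by blast
  qed (use that in auto)
  have "(F \<longlongrightarrow> 0\<^sup>2 * (0\<^sup>2 + 0\<^sup>2) - (2 * \<mu> + 1) * 0 * (0 * 0)) (at_right 0)"
    unfolding F_def u_def v_def using assms by (intro tendsto_intros bessel_J_tendsto_at_right_0) auto
  then have lim: "(F \<longlongrightarrow> 0) (at_right 0)" by simp
  have nonneg: "F t \<ge> 0" if "t > 0" for t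
  proof (rule tendsto_upperbound[OF lim])
    show "\<forall>\<^sub>F s in at_right 0. F s \<le> F t"
      using that mono unfolding eventually_at_right_field by (intro exI[of _ t]) auto
  qed simp
  \<comment> \<open>Monotonicity and the limit give only \<open>F x \<ge> 0\<close>. Strictness
    comes from a stretch near 0 on which \<open>u\<close> is positive and \<open>F\<close> therefore
    strictly increases.\<close>
  obtain e where e: "e > 0" "\<And>t. 0 < t \<Longrightarrow> t < e \<Longrightarrow> u t > 0"
    using bessel_J_pos_at_right_0[of \<mu>] assms unfolding u_def eventually_at_right_field by force
  define b where "b = min (e / 2) x"
  have b: "0 < b" "b < e" "b \<le> x" using e(1) assms by (auto simp: b_def)
  have "F (b / 2) < F b"
  proof (rule DERIV_pos_imp_increasing[of _ _ F])
    fix t assume "b / 2 \<le> t" "t \<le> b"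
    then have t: "t > 0" "u t > 0" using b e(2) by auto
    then have "t * ((u t)\<^sup>2 + (v t)\<^sup>2) > 0"
      by (intro mult_pos_pos add_pos_nonneg) auto
    then show "\<exists>y. (F has_real_derivative y) (at t) \<and> 0 < y" using deriv t by blast
  qed (use b in auto)
  then have "F x > 0" using nonneg[of "b / 2"] mono[of b x] b by linarith
  moreover have "F x = x\<^sup>2 * ((u x)\<^sup>2 + (v x)\<^sup>2
    - (2 * \<mu> + 1) / x * (u x * v x))"
    using assms by (simp add: F_def field_simps power2_eq_square)
  ultimately show ?thesis using assms unfolding u_def v_def by (simp add: zero_less_mult_iff)
qed

text \<open>
  \<open>r = bessel_J (\<mu> + 1) / bessel_J \<mu>\<close> solves a Riccati equation, which forces
  \<open>(arctan r)' \<ge> 1 / 2\<close> far out; as \<open>arctan\<close> is bounded, \<open>r\<close> must have poles.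
\<close>
lemma bessel_J_zeros_unbounded:
  assumes "\<mu> \<ge> 0"
  shows "\<exists>z>b. bessel_J \<mu> z = 0"
proof (rule ccontr)
  assume neg: "\<not> ?thesis"
  \<comment> \<open>Beyond \<open>2 * \<mu> + 1\<close> the coefficient of the linear term in the
    Riccati equation is at most 1, so half of \<open>1 + r^2\<close> absorbs that term.\<close>
  define X where "X = max (\<bar>b\<bar> + 1) (2 * \<mu> + 1)"
  have X: "X > 0" "X > b" "X \<ge> 2 * \<mu> + 1" by (auto simp: X_def)
  define r where "r x = bessel_J (\<mu> + 1) x / bessel_J \<mu> x" for x
  define f where "f x = arctan (r x) - x / 2" for x
  \<comment> \<open>Over a length of \<open>2 * pi\<close> the term \<open>x / 2\<close> grows by
    \<open>pi\<close>, more than \<open>arctan\<close>, with values strictly between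
    \<open>- pi / 2\<close> and \<open>pi / 2\<close>, can make up for.\<close>
  have "f X \<le> f (X + 2 * pi)"
  proof (rule DERIV_nonneg_imp_nondecreasing[of _ _ f])
    fix x assume "X \<le> x"
    then have x: "x > 0" "x \<ge> 2 * \<mu> + 1" "bessel_J \<mu> x \<noteq> 0" using X neg by auto
    have r: "(r has_real_derivative 1 + (r x)\<^sup>2 - (2 * \<mu> + 1) / x * r x) (at x)"
      unfolding r_def[abs_def] using x assms
      by (auto intro!: derivative_eq_intros DERIV_bessel_J[of \<mu> x] DERIV_bessel_J_Suc[of \<mu> x]
          simp: divide_simps) (simp add: algebra_simps power2_eq_square)
    have "\<bar>(2 * \<mu> + 1) / x * r x\<bar> \<le> 1 * \<bar>r x\<bar>"
      unfolding abs_mult using x assms by (intro mult_right_mono) auto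
    moreover have "\<bar>r x\<bar> \<le> (1 + (r x)\<^sup>2) / 2"
      using sum_squares_bound[of 1 "\<bar>r x\<bar>"] by simp
    ultimately have "(2 * \<mu> + 1) / x * r x \<le> (1 + (r x)\<^sup>2) / 2" by linarith
    then have "(1 + (r x)\<^sup>2) / 2 \<le> 1 + (r x)\<^sup>2 - (2 * \<mu> + 1) / x * r x"
      unfolding add_divide_distrib by linarith
    moreover have "1 + (r x)\<^sup>2 > 0" by (simp add: add_pos_nonneg)
    ultimately have "1 / 2 \<le> inverse (1 + (r x)\<^sup>2) * (1 + (r x)\<^sup>2 - (2 * \<mu> + 1) / x * r x)"
      by (simp add: pos_le_divide_eq mult.commute[of "inverse _"] flip: divide_inverse)
    moreover have "(f has_real_derivative
        inverse (1 + (r x)\<^sup>2) * (1 + (r x)\<^sup>2 - (2 * \<mu> + 1) / x * r x) - 1 / 2) (at x)"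
      unfolding f_def
      by (intro DERIV_diff DERIV_chain2[OF DERIV_arctan r]) (auto intro!: derivative_eq_intros)
    ultimately show "\<exists>y. (f has_real_derivative y) (at x) \<and> 0 \<le> y" by force
  qed simp
  then show False
    using arctan_lbound[of "r X"] arctan_ubound[of "r (X + 2 * pi)"] by (simp add: f_def field_simps)
qed

section \<open>Lommel polynomials\<close>

text \<open>Beyond \<open>n div 2\<close> the binomial coefficient vanishes, so sums for different
  \<open>n\<close> can share one range of summation.\<close>

lemma lommel_R_nat:
  assumes "n \<le> N"
  shows "lommel_R (int n) l x = (\<Sum>k\<le>N. (-1) ^ k * real ((n - k) choose k)
    * (Gamma (l + real n - real k) / Gamma (l + real k)) * (x / 2) powi (2 * int k - int n))"
proof -
  have "lommel_R (int n) l x = (\<Sum>k\<in>{0..n div 2}. (-1) ^ k * real ((n - k) choose k)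
    * (Gamma (l + real n - real k) / Gamma (l + real k)) * (x / 2) powi (2 * int k - int n))"
    by (simp add: lommel_R_def)
  also have "\<dots> = (\<Sum>k\<le>N. (-1) ^ k * real ((n - k) choose k)
    * (Gamma (l + real n - real k) / Gamma (l + real k)) * (x / 2) powi (2 * int k - int n))"
  proof (rule sum.mono_neutral_left)
    show "\<forall>k\<in>{..N} - {0..n div 2}. (-1) ^ k * real ((n - k) choose k)
      * (Gamma (l + real n - real k) / Gamma (l + real k)) * (x / 2) powi (2 * int k - int n) = 0"
      by (auto intro!: binomial_eq_0)
  qed (use assms in auto)
  finally show ?thesis .
qed

text \<open>This is absorption for the upper entry \<open>n - k\<close>. If
  \<open>k > n - k\<close>, the factor \<open>real n - 2 * real k\<close> is negative, but both
  binomial coefficients are 0.\<close>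

lemma absorb_choose_diff:
  assumes "k \<le> n"
  shows "(real k + 1) * real ((n - k) choose Suc k) = (real n - 2 * real k) * real ((n - k) choose k)"
proof -
  let ?N = "n - k"
  have "Suc k * (?N choose Suc k) = (?N - k) * (?N choose k)"
    by (rule trans[OF binomial_absorption binomial_absorb_comp[symmetric]])
  then have "real (Suc k) * real (?N choose Suc k) = real (?N - k) * real (?N choose k)"
    by (simp only: of_nat_mult[symmetric])
  also have "\<dots> = (real n - 2 * real k) * real (?N choose k)"
    using assms by (cases "k \<le> ?N") (simp_all add: of_nat_diff binomial_eq_0)
  finally show ?thesis by (simp add: add.commute)
qed

text \<open>The recurrence already holds between the terms \<open>T (n + 2) (Suc k)\<close>,
  \<open>T (n + 1) (Suc k)\<close> and \<open>T n k\<close>: Pascal's rule splits the first binomial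
  coefficient, and after the common factors are removed \<open>absorb_choose_diff\<close>
  remains.\<close>

lemma lommel_R_recurrence_nat:
  assumes "l > 0" "x > 0"
  shows "lommel_R (int n + 2) l x = 2 * (l + real n + 1) / x * lommel_R (int n + 1) l x - lommel_R (int n) l x"
proof -
  define T where "T n k = (-1) ^ k * real ((n - k) choose k)
    * (Gamma (l + real n - real k) / Gamma (l + real k)) * (x / 2) powi (2 * int k - int n)" for n k
  have T: "lommel_R (int n) l x = (\<Sum>k\<le>N. T n k)" if "n \<le> N" for n N
    unfolding T_def using that by (rule lommel_R_nat)
  have t0: "T (n + 2) 0 = 2 * (l + real n + 1) / x * T (n + 1) 0"
  proof -
    have G: "Gamma (l + real n + 2) = (l + real n + 1) * Gamma (l + real n + 1)"
      using Gamma_plus1[of "l + real n + 1"] assms by (auto simp: nonpos_Ints_def add.assoc)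
    have p: "(x / 2) powi (- 1 - int n) = (x / 2) powi (- int n - 2) * (x / 2)"
    proof -
      have "- 1 - int n = - int n - 2 + 1" by simp
      then show ?thesis using assms by (simp only:) (intro power_int_add_1, simp)
    qed
    have t2: "T (n + 2) 0 = Gamma (l + real n + 2) / Gamma l * (x / 2) powi (- int n - 2)"
      and t1: "T (n + 1) 0 = Gamma (l + real n + 1) / Gamma l * (x / 2) powi (- 1 - int n)"
      by (simp_all add: T_def algebra_simps)
    show ?thesis unfolding t1 t2 G p using assms by (simp add: Gamma_eq_zero_iff divide_simps)
  qed
  have tS: "T (n + 2) (Suc k) = 2 * (l + real n + 1) / x * T (n + 1) (Suc k) - T n k" if "k \<le> n + 1" for k
  proof (cases "k \<le> n")
    case False
    \<comment> \<open>All three terms vanish here, because their binomial coefficients have upper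
      entry 0.\<close>
    then have "k = n + 1" using that by simp
    then show ?thesis by (simp add: T_def)
  next
    case True
    define G where "G = Gamma (l + real n - real k)"
    define H where "H = Gamma (l + real k)"
    define p where "p = (x / 2) powi (2 * int k - int n)"
    define a where "a = real ((n - k) choose Suc k)"
    define b where "b = real ((n - k) choose k)"
    have G: "Gamma (l + real n - real k + 1) = (l + real n - real k) * G"
      unfolding G_def using True assms by (intro Gamma_plus1) (auto simp: nonpos_Ints_def)
    have H: "Gamma (l + real k + 1) = (l + real k) * H" "H > 0"
      unfolding H_def using assms by (auto intro!: Gamma_plus1 Gamma_real_pos simp: nonpos_Ints_def)
    have p: "(x / 2) powi (2 * int k - int n + 1) = p * (x / 2)"
      unfolding p_def using assms by (simp add: power_int_add_1)
    have c: "(n + 1 - k) choose Suc k = ((n - k) choose Suc k) + ((n - k) choose k)"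
      using True by (simp add: Suc_diff_le)
    have ab: "(real k + 1) * a = (real n - 2 * real k) * b"
      unfolding a_def b_def using True by (rule absorb_choose_diff)
    have e1: "T (n + 2) (Suc k) = - ((-1) ^ k * (a + b) * ((l + real n - real k) * G / ((l + real k) * H)) * p)"
    proof -
      have "n + 2 - Suc k = n + 1 - k" "l + real (n + 2) - real (Suc k) = l + real n - real k + 1"
        "l + real (Suc k) = l + real k + 1" "2 * int (Suc k) - int (n + 2) = 2 * int k - int n"
        using True by auto
      then show ?thesis unfolding T_def by (simp only: c G H(1)) (simp add: a_def b_def p_def)
    qed
    have e2: "T (n + 1) (Suc k) = - ((-1) ^ k * a * (G / ((l + real k) * H)) * (p * (x / 2)))"
    proof -
      have "n + 1 - Suc k = n - k" "l + real (n + 1) - real (Suc k) = l + real n - real k"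
        "l + real (Suc k) = l + real k + 1" "2 * int (Suc k) - int (n + 1) = 2 * int k - int n + 1"
        using True by auto
      then show ?thesis unfolding T_def by (simp only: p H(1)) (simp add: a_def G_def)
    qed
    have e3: "T n k = (-1) ^ k * b * (G / H) * p"
      by (simp add: T_def b_def G_def H_def p_def)
    have "(a + b) * (l + real n - real k) = (l + real n + 1) * a + (l + real k) * b"
      using ab by (simp add: algebra_simps)
    then have key: "(a + b) * ((l + real n - real k) * G / ((l + real k) * H))
        = (l + real n + 1) * (a * (G / ((l + real k) * H))) + b * (G / H)"
      using H(2) assms by (simp add: divide_simps) (simp add: algebra_simps)
    \<comment> \<open>The Gamma quotients become opaque letters \<open>C1\<close>,
      \<open>C2\<close>, \<open>C3\<close>, tied together only by the linear relation
      \<open>key\<close>.\<close>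
    have "- (s * (a + b) * C1 * p) = 2 * (l + real n + 1) / x * - (s * a * C2 * (p * (x / 2))) - s * b * C3 * p"
      if "(a + b) * C1 = (l + real n + 1) * (a * C2) + b * C3" for s C1 C2 C3
    proof -
      have "- (s * (a + b) * C1 * p) = - s * ((a + b) * C1) * p" by (simp add: algebra_simps)
      also have "\<dots> = 2 * (l + real n + 1) / x * - (s * a * C2 * (p * (x / 2))) - s * b * C3 * p"
        unfolding that using assms by (simp add: field_simps)
      finally show ?thesis .
    qed
    from this[OF key] show ?thesis unfolding e1 e2 e3 .
  qed
  have "lommel_R (int (n + 2)) l x = T (n + 2) 0 + (\<Sum>k\<le>n + 1. T (n + 2) (Suc k))"
    using T[of "n + 2" "Suc (n + 1)"] by (simp only: sum.atMost_Suc_shift)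
  also have "\<dots> = 2 * (l + real n + 1) / x * (T (n + 1) 0 + (\<Sum>k\<le>n + 1. T (n + 1) (Suc k))) - (\<Sum>k\<le>n + 1. T n k)"
    using t0 tS by (simp add: sum_subtractf sum_distrib_left ring_distribs)
  also have "T (n + 1) 0 + (\<Sum>k\<le>n + 1. T (n + 1) (Suc k)) = lommel_R (int (n + 1)) l x"
    using T[of "n + 1" "Suc (n + 1)"] by (simp only: sum.atMost_Suc_shift)
  also have "(\<Sum>k\<le>n + 1. T n k) = lommel_R (int n) l x"
    using T[of n "n + 1"] by simp
  finally show ?thesis by (simp add: add.commute)
qed

lemma lommel_R_0: "l > 0 \<Longrightarrow> lommel_R 0 l x = 1"
  by (auto simp: lommel_R_def dest: Gamma_real_pos)

lemma lommel_R_1: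
  assumes "l > 0" "x > 0"
  shows "lommel_R 1 l x = 2 * l / x"
proof -
  have "Gamma (l + 1) = l * Gamma l"
    using assms by (intro Gamma_plus1) (auto simp: nonpos_Ints_def)
  moreover have "Gamma l \<noteq> 0" using assms by (auto dest: Gamma_real_pos)
  ultimately show ?thesis
    using assms by (simp add: lommel_R_def power_int_minus field_simps)
qed

text \<open>The conventional values at \<open>-1\<close> and \<open>-2\<close> are those that
  continue the recurrence backwards. They enter \<open>lommel_R_star m\<close> for
  \<open>m = 0\<close> and \<open>m = 1\<close>.\<close>

lemma lommel_R_recurrence:
  assumes "l > 0" "x > 0" "n \<ge> -2"
  shows "lommel_R (n + 2) l x = 2 * (l + of_int n + 1) / x * lommel_R (n + 1) l x - lommel_R n l x"
proof -
  consider "n = -2" | "n = -1" | "n \<ge> 0" using assms(3) by linarith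
  then show ?thesis
  proof cases
    case 1
    then show ?thesis using assms by (simp add: lommel_R_0) (simp add: lommel_R_def)
  next
    case 2
    then show ?thesis using assms by (simp add: lommel_R_0 lommel_R_1) (simp add: lommel_R_def)
  next
    case 3
    then show ?thesis using lommel_R_recurrence_nat[OF assms(1,2), of "nat n"] by simp
  qed
qed

section \<open>The associated polynomials\<close>

lemma lommel_R_star_0: "\<nu> > 0 \<Longrightarrow> lommel_R_star 0 \<nu> x = 1"
  by (simp add: lommel_R_star_def lommel_R_0) (simp add: lommel_R_def)

lemma lommel_R_star_1: "\<nu> > 0 \<Longrightarrow> x > 0 \<Longrightarrow> lommel_R_star (Suc 0) \<nu> x = \<nu> / x"
  by (simp add: lommel_R_star_def lommel_R_1) (simp add: lommel_R_def)

text \<open>Lowering the index by 2 and raising the parameter by 2 leaves the coefficient unchanged,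
  so both constituents satisfy the same linear recurrence.\<close>

lemma lommel_R_star_recurrence:
  assumes "\<nu> > 0" "x > 0"
  shows "lommel_R_star (Suc (Suc n)) \<nu> x
    = 2 * (\<nu> + real n + 1) / x * lommel_R_star (Suc n) \<nu> x - lommel_R_star n \<nu> x"
proof -
  have "lommel_R (int n) (\<nu> + 2) x = 2 * (\<nu> + real n + 1) / x * lommel_R (int n - 1) (\<nu> + 2) x
      - lommel_R (int n - 2) (\<nu> + 2) x"
    using lommel_R_recurrence[of "\<nu> + 2" x "int n - 2"] assms by (simp add: algebra_simps)
  moreover have "lommel_R (int n + 2) \<nu> x = 2 * (\<nu> + real n + 1) / x * lommel_R (int n + 1) \<nu> x
      - lommel_R (int n) \<nu> x"
    using lommel_R_recurrence[of \<nu> x "int n"] assms by simp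
  ultimately have *: "lommel_R (int n + 2) \<nu> x - lommel_R (int n) (\<nu> + 2) x
    = 2 * (\<nu> + real n + 1) / x * (lommel_R (int n + 1) \<nu> x - lommel_R (int n - 1) (\<nu> + 2) x)
      - (lommel_R (int n) \<nu> x - lommel_R (int n - 2) (\<nu> + 2) x)"
    by (simp only: right_diff_distrib)
  have "int (Suc (Suc n)) = int n + 2" "int (Suc (Suc n)) - 2 = int n"
    "int (Suc n) = int n + 1" "int (Suc n) - 2 = int n - 1" by auto
  then show ?thesis unfolding lommel_R_star_def by (simp only: * diff_divide_distrib right_diff_distrib times_divide_eq_right)
qed

lemma DERIV_lommel_R_star_recurrence:
  assumes "\<nu> > 0" "x > 0"
    and "(lommel_R_star n \<nu> has_real_derivative a) (at x)"
    and "(lommel_R_star (Suc n) \<nu> has_real_derivative b) (at x)"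
  shows "(lommel_R_star (Suc (Suc n)) \<nu> has_real_derivative
    2 * (\<nu> + real n + 1) / x * b - 2 * (\<nu> + real n + 1) / x\<^sup>2 * lommel_R_star (Suc n) \<nu> x - a) (at x)"
proof -
  have "((\<lambda>x. 2 * (\<nu> + real n + 1) / x * lommel_R_star (Suc n) \<nu> x - lommel_R_star n \<nu> x)
    has_real_derivative
    2 * (\<nu> + real n + 1) / x * b - 2 * (\<nu> + real n + 1) / x\<^sup>2 * lommel_R_star (Suc n) \<nu> x - a) (at x)"
    using assms by (auto intro!: derivative_eq_intros simp: field_simps power2_eq_square)
  then show ?thesis
    by (rule has_field_derivative_transform_within_open[where S = "{0<..}"])
      (use assms in \<open>auto simp: lommel_R_star_recurrence\<close>)
qed

lemma DERIV_lommel_R_star_0: "\<nu> > 0 \<Longrightarrow> (lommel_R_star 0 \<nu> has_real_derivative 0) (at x)"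
proof -
  assume "\<nu> > 0"
  then have "lommel_R_star 0 \<nu> = (\<lambda>_. 1)" by (intro ext lommel_R_star_0)
  then show ?thesis by simp
qed

lemma DERIV_lommel_R_star_1:
  assumes "\<nu> > 0" "x > 0"
  shows "(lommel_R_star (Suc 0) \<nu> has_real_derivative - (\<nu> / x\<^sup>2)) (at x)"
proof -
  have "((\<lambda>x. \<nu> / x) has_real_derivative - (\<nu> / x\<^sup>2)) (at x)"
    using assms by (auto intro!: derivative_eq_intros simp: power2_eq_square)
  then show ?thesis
    by (rule has_field_derivative_transform_within_open[where S = "{0<..}"])
      (use assms in \<open>auto simp: lommel_R_star_1\<close>)
qed

lemma DERIV_lommel_R_star:
  assumes "\<nu> > 0" "x > 0"
  shows "(lommel_R_star n \<nu> has_real_derivative deriv (lommel_R_star n \<nu>) x) (at x)"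
proof -
  have "\<exists>d. (lommel_R_star n \<nu> has_real_derivative d) (at x)"
  proof (induction n rule: induct_nat_012)
    case 0
    show ?case using DERIV_lommel_R_star_0 assms by blast
  next
    case 1
    show ?case using DERIV_lommel_R_star_1 assms by blast
  next
    case (ge2 n)
    then show ?case using DERIV_lommel_R_star_recurrence assms by blast
  qed
  then show ?thesis using DERIV_imp_deriv by metis
qed

text \<open>The Christoffel--Darboux argument: the left-hand side decreases with \<open>n\<close>.\<close>
lemma lommel_R_star_consecutive_wronskian_neg:
  assumes "\<nu> > 0" "x > 0"
  shows "deriv (lommel_R_star (Suc n) \<nu>) x * lommel_R_star n \<nu> x
    - lommel_R_star (Suc n) \<nu> x * deriv (lommel_R_star n \<nu>) x < 0"
proof (induction n)
  case 0
  have "deriv (lommel_R_star 0 \<nu>) x = 0" "deriv (lommel_R_star (Suc 0) \<nu>) x = - (\<nu> / x\<^sup>2)"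
    using assms by (auto intro!: DERIV_imp_deriv DERIV_lommel_R_star_0 DERIV_lommel_R_star_1)
  then show ?case using assms by (simp add: lommel_R_star_0)
next
  case (Suc n)
  define p p' q q' c where "p = lommel_R_star n \<nu> x" "p' = deriv (lommel_R_star n \<nu>) x"
    "q = lommel_R_star (Suc n) \<nu> x" "q' = deriv (lommel_R_star (Suc n) \<nu>) x"
    "c = 2 * (\<nu> + real n + 1)"
  note defs = this
  have "deriv (lommel_R_star (Suc (Suc n)) \<nu>) x = c / x * q' - c / x\<^sup>2 * q - p'"
    unfolding defs using assms
    by (intro DERIV_imp_deriv DERIV_lommel_R_star_recurrence DERIV_lommel_R_star)
  moreover have "lommel_R_star (Suc (Suc n)) \<nu> x = c / x * q - p"
    unfolding defs using assms by (rule lommel_R_star_recurrence)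
  \<comment> \<open>The coefficient \<open>c / x\<close> depends on \<open>x\<close>; its derivative
    contributes the negative square, the only change in the Wronskian.\<close>
  moreover have "(c / x * q' - c / x\<^sup>2 * q - p') * q - (c / x * q - p) * q'
      = (q' * p - q * p') - c / x\<^sup>2 * q\<^sup>2"
    by (simp add: algebra_simps power2_eq_square)
  moreover have "c / x\<^sup>2 * q\<^sup>2 \<ge> 0" using assms by (simp add: defs)
  ultimately show ?case using Suc by (simp add: defs)
qed

text \<open>For \<open>x \<le> \<nu>\<close> the coefficient in the recurrence is at least 2, so
  each increment in \<open>n\<close> is at least the preceding one. The resulting bound of 1 on the
  ratio of consecutive polynomials settles the sign near 0 in the theorem.\<close>

lemma lommel_R_star_mono_near_0:
  assumes "0 < x" "x \<le> \<nu>"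
  shows "0 < lommel_R_star n \<nu> x \<and> lommel_R_star n \<nu> x \<le> lommel_R_star (Suc n) \<nu> x"
proof (induction n)
  case 0
  show ?case using assms by (simp add: lommel_R_star_0 lommel_R_star_1)
next
  case (Suc n)
  have "2 * x \<le> 2 * (\<nu> + real n + 1)" using assms(2) by simp
  then have "2 \<le> 2 * (\<nu> + real n + 1) / x" using assms(1) by (simp only: pos_le_divide_eq)
  then have "2 * lommel_R_star (Suc n) \<nu> x \<le> 2 * (\<nu> + real n + 1) / x * lommel_R_star (Suc n) \<nu> x"
    using Suc by (intro mult_right_mono) auto
  then show ?case using Suc assms lommel_R_star_recurrence[of \<nu> x n] by linarith
qed

section \<open>Interlacing\<close>

lemma bessel_J_lommel_R_star_casoratian:
  assumes "\<nu> > 0" "x > 0"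
  shows "bessel_J (\<nu> + real n) x * lommel_R_star (Suc n) \<nu> x
    - bessel_J (\<nu> + real n + 1) x * lommel_R_star n \<nu> x = bessel_J' \<nu> x"
proof (induction n)
  case 0
  have "bessel_J' \<nu> x = \<nu> / x * bessel_J \<nu> x - bessel_J (\<nu> + 1) x"
    unfolding bessel_J'_def using assms by (intro DERIV_imp_deriv DERIV_bessel_J) auto
  then show ?case using assms by (simp add: lommel_R_star_0 lommel_R_star_1)
next
  case (Suc n)
  have "bessel_J (\<nu> + real n + 2) x
      = 2 * (\<nu> + real n + 1) / x * bessel_J (\<nu> + real n + 1) x - bessel_J (\<nu> + real n) x"
    using bessel_J_recurrence[of "\<nu> + real n" x] assms by simp
  moreover have "\<nu> + real (Suc n) = \<nu> + real n + 1" "\<nu> + real (Suc n) + 1 = \<nu> + real n + 2" by simp_all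
  ultimately show ?case
    using Suc by (simp only: lommel_R_star_recurrence[OF assms]) (simp add: algebra_simps)
qed

theorem theorem5p1:
  fixes \<nu> :: real and m :: nat
  assumes "\<nu> > 0"
  shows "\<exists>j' \<omega>. increasing_enumeration (bessel_J'_zeros \<nu> - common_zeros m \<nu>) j'
           \<and> increasing_enumeration (omega_set m \<nu>) \<omega>
           \<and> 0 < j' 0
           \<and> (\<forall>l. j' l < \<omega> l \<and> \<omega> l < j' (Suc l))"
proof -
  define \<mu> where "\<mu> = \<nu> + real m"
  have \<mu>: "\<mu> > 0" using assms by (simp add: \<mu>_def)
  let ?v = "lommel_R_star m \<nu>" and ?v1 = "lommel_R_star (Suc m) \<nu>"
  \<comment> \<open>The minus sign in \<open>?u1\<close> gives the Bessel quotient a negative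
    Wronskian, like that of the Lommel quotient.\<close>
  let ?u = "bessel_J \<mu>" and ?u1 = "\<lambda>x. - bessel_J (\<mu> + 1) x"
  let ?q = "\<lambda>x. ?v1 x / ?v x + ?u1 x / ?u x"
  let ?Z = "{x. x > 0 \<and> ?v x * ?u x = 0}"
  have casoratian: "?u x * ?v1 x - bessel_J (\<mu> + 1) x * ?v x = bessel_J' \<nu> x" if "x > 0" for x
    unfolding \<mu>_def using bessel_J_lommel_R_star_casoratian[OF assms that] .
  have wv: "deriv ?v1 x * ?v x - ?v1 x * deriv ?v x < 0" if "x > 0" for x
    using lommel_R_star_consecutive_wronskian_neg[OF assms that] .
  have "\<exists>j w. increasing_enumeration {x. x > 0 \<and> x \<notin> ?Z \<and> ?q x = 0} j
           \<and> increasing_enumeration ?Z w \<and> 0 < j 0 \<and> (\<forall>l. j l < w l \<and> w l < j (Suc l))"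
  proof (rule zeros_poles_of_decreasing_quotients_interlace)
    fix x :: real assume x: "x > 0"
    show "(?v has_real_derivative deriv ?v x) (at x)" "(?v1 has_real_derivative deriv ?v1 x) (at x)"
      using assms x by (rule DERIV_lommel_R_star)+
    show "(?u has_real_derivative \<mu> / x * ?u x - bessel_J (\<mu> + 1) x) (at x)"
      using \<mu> x by (intro DERIV_bessel_J) auto
    show "(?u1 has_real_derivative - (?u x - (\<mu> + 1) / x * bessel_J (\<mu> + 1) x)) (at x)"
      using \<mu> x by (intro DERIV_minus DERIV_bessel_J_Suc) auto
    show "deriv ?v1 x * ?v x - ?v1 x * deriv ?v x < 0" using wv[OF x] .
    have "- (?u x - (\<mu> + 1) / x * bessel_J (\<mu> + 1) x) * ?u x
        - ?u1 x * (\<mu> / x * ?u x - bessel_J (\<mu> + 1) x)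
      = - ((?u x)\<^sup>2 + (bessel_J (\<mu> + 1) x)\<^sup>2 - (2 * \<mu> + 1) / x * (?u x * bessel_J (\<mu> + 1) x))"
      using x by (simp add: field_simps power2_eq_square)
    also have "\<dots> < 0"
      using bessel_J_consecutive_form_pos[OF \<mu> x] by (simp only: neg_less_0_iff_less)
    finally show "- (?u x - (\<mu> + 1) / x * bessel_J (\<mu> + 1) x) * ?u x
        - ?u1 x * (\<mu> / x * ?u x - bessel_J (\<mu> + 1) x) < 0" .
  next
    have near: "\<forall>\<^sub>F x in at_right 0. 0 < ?v x \<and> ?v x \<le> ?v1 x"
      using lommel_R_star_mono_near_0[of _ \<nu> m] assms
      unfolding eventually_at_right_field by (intro exI[of _ \<nu>]) auto
    then show "\<forall>\<^sub>F x in at_right 0. ?v x \<noteq> 0" by eventually_elim auto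
    show "\<forall>\<^sub>F x in at_right 0. ?u x \<noteq> 0"
      using bessel_J_pos_at_right_0[OF less_imp_le[OF \<mu>]] by eventually_elim auto
    \<comment> \<open>The Bessel quotient tends to 0, while the Lommel quotient stays at least
      1.\<close>
    have "\<forall>\<^sub>F x in at_right 0. bessel_J (\<mu> + 1) x / ?u x < 1"
      using bessel_J_quotient_tendsto_at_right_0[OF less_imp_le[OF \<mu>]] by (rule order_tendstoD) simp
    with near show "\<forall>\<^sub>F x in at_right 0. ?q x > 0"
    proof eventually_elim
      case (elim x)
      then have "?v1 x / ?v x \<ge> 1" by simp
      then show ?case using elim(2) unfolding minus_divide_left[symmetric] by linarith
    qed
  next
    fix b
    show "\<exists>z>b. ?v z * ?u z = 0"
      using bessel_J_zeros_unbounded[of \<mu> b] \<mu> by auto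
  qed
  moreover have "{x. x > 0 \<and> x \<notin> ?Z \<and> ?q x = 0} = bessel_J'_zeros \<nu> - common_zeros m \<nu>"
  proof -
    have "x \<notin> ?Z \<and> ?q x = 0 \<longleftrightarrow> bessel_J' \<nu> x = 0 \<and> ?u x \<noteq> 0" if x: "x > 0" for x
    \<comment> \<open>At a zero of \<open>?v\<close> the Casoratian is \<open>?u x * ?v1 x\<close>
      with \<open>?v1 x \<noteq> 0\<close>, so \<open>bessel_J'\<close> vanishes there only together
      with \<open>?u\<close> and both sides are false. Hence discarding the poles removes exactly
      the common zeros.\<close>
    proof (cases "?v x = 0")
      case True
      then have "?v1 x \<noteq> 0" using wv[OF x] by auto
      then show ?thesis using True x casoratian[OF x] by auto
    next
      case False
      then show ?thesis using x casoratian[OF x] by (auto simp: field_simps)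
    qed
    then show ?thesis by (auto simp: bessel_J'_zeros_def common_zeros_def \<mu>_def)
  qed
  moreover have "?Z = omega_set m \<nu>" by (auto simp: omega_set_def \<mu>_def)
  ultimately show ?thesis by simp
qed

end
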